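(* Let $X$ be a Tychonoff space with a countable $\pi$-base. The following are equivalent: (a) $C_{kh}(X)$ is separable; (b) $C_{ph}(X)$ is separable; (c) $X$ is an $R$-separable submetrizable space.
   Context: Tychonoff means completely regular and Hausdorff. A $\pi$-base of a space is a family of nonempty open sets such that every nonempty open set contains a member of the family. $C(X)$ is the set of all continuous functions $X\to\mathbb{R}$. For $A\subseteq X$ and $V\subseteq\mathbb{R}$ put $[A,V]^+=\{f\in C(X): f(A)\subseteq V\}$; for $U\subseteq X$ and $r\in\mathbb{R}$ put $[U,r]^-=\{f\in C(X): f^{-1}(r)\cap U\neq\emptyset\}$. $C_{kh}(X)$ is $C(X)$ with the topology with subbase all $[A,V]^+$ ($A\subseteq X$ compact, $V\subseteq\mathbb{R}$ open) together with all $[U,r]^-$ ($U\subseteq X$ open, $r\in\mathbb{R}$). $C_{ph}(X)$ is $C(X)$ with the topology with subbase all $[\{x\},V]^+$ ($x\in X$, $V\subseteq\mathbb{R}$ open) together with all $[U,r]^-$ ($U\subseteq X$ open, $r\in\mathbb{R}$). A nonempty subset $B$ of $X$ is an $R$-set if there is a countable collection $\{f_n:n\in\mathbb{N}\}\subseteq C(X)$ with $\bigcup_{n\in\mathbb{N}} f_n(B)=\mathbb{R}$. $X$ is $R$-separable if there is a countable collection of $R$-sets in $X$ such that every nonempty open set in $X$ contains some member of this collection. $X$ is submetrizable if it admits a weaker (coarser or equal) metrizable topology. *)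

theory Defs
  imports "HOL-Analysis.Analysis"
begin

definition tychonoff_space :: "'a topology \<Rightarrow> bool" where
  "tychonoff_space X \<longleftrightarrow> completely_regular_space X \<and> Hausdorff_space X"

definition pi_base :: "'a topology \<Rightarrow> 'a set set \<Rightarrow> bool" where
  "pi_base X \<P> \<longleftrightarrow>
     (\<forall>P\<in>\<P>. openin X P \<and> P \<noteq> {}) \<and>
     (\<forall>U. openin X U \<and> U \<noteq> {} \<longrightarrow> (\<exists>P\<in>\<P>. P \<subseteq> U))"

text \<open>
  Functions on the underlying set of \<open>X\<close> are represented by extensional functions on the
  ambient type, so that each continuous function has exactly one representative.
\<close>

definition cont_funs :: "'a topology \<Rightarrow> ('a \<Rightarrow> real) set" where
  "cont_funs X = {f. continuous_map X euclideanreal f \<and> f \<in> extensional (topspace X)}"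

definition plus_set :: "'a topology \<Rightarrow> 'a set \<Rightarrow> real set \<Rightarrow> ('a \<Rightarrow> real) set" where
  "plus_set X A V = {f \<in> cont_funs X. f ` A \<subseteq> V}"

definition minus_set :: "'a topology \<Rightarrow> 'a set \<Rightarrow> real \<Rightarrow> ('a \<Rightarrow> real) set" where
  "minus_set X U r = {f \<in> cont_funs X. f -` {r} \<inter> U \<noteq> {}}"

text \<open>
  The whole set \<open>cont_funs X\<close> (the empty intersection of subbasic sets) is inserted because
  \<open>topology_generated_by\<close> takes the union of the generators as the underlying set. It only
  matters for \<open>C_ph\<close> of the empty space.
\<close>

definition C_kh :: "'a topology \<Rightarrow> ('a \<Rightarrow> real) topology" where
  "C_kh X = topology_generated_by (insert (cont_funs X)
     ({plus_set X A V | A V. compactin X A \<and> open V} \<union>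
      {minus_set X U r | U r. openin X U}))"

definition C_ph :: "'a topology \<Rightarrow> ('a \<Rightarrow> real) topology" where
  "C_ph X = topology_generated_by (insert (cont_funs X)
     ({plus_set X {x} V | x V. x \<in> topspace X \<and> open V} \<union>
      {minus_set X U r | U r. openin X U}))"

definition R_set :: "'a topology \<Rightarrow> 'a set \<Rightarrow> bool" where
  "R_set X B \<longleftrightarrow> B \<subseteq> topspace X \<and> B \<noteq> {} \<and>
     (\<exists>f :: nat \<Rightarrow> 'a \<Rightarrow> real. (\<forall>n. f n \<in> cont_funs X) \<and> (\<Union>n. f n ` B) = UNIV)"

definition R_separable :: "'a topology \<Rightarrow> bool" where
  "R_separable X \<longleftrightarrow>
     (\<exists>\<B>. countable \<B> \<and> (\<forall>B\<in>\<B>. R_set X B) \<and>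
          (\<forall>U. openin X U \<and> U \<noteq> {} \<longrightarrow> (\<exists>B\<in>\<B>. B \<subseteq> U)))"

definition submetrizable_space :: "'a topology \<Rightarrow> bool" where
  "submetrizable_space X \<longleftrightarrow>
     (\<exists>Y. metrizable_space Y \<and> topspace Y = topspace X \<and> (\<forall>U. openin Y U \<longrightarrow> openin X U))"

end

theory Submission
  imports Defs
begin

text \<open>
  The topology of \<open>C_ph X\<close> is coarser than that of \<open>C_kh X\<close> on the same underlying set, so
  separability passes from \<open>C_kh X\<close> to \<open>C_ph X\<close>.

  Let \<open>D\<close> be a countable dense subset of \<open>C_ph X\<close>. For a nonempty open \<open>U\<close> and a real \<open>r\<close> the set
  \<open>minus_set X U r\<close> is open and contains a constant function, so some member of \<open>D\<close> takes the value
  \<open>r\<close> on \<open>U\<close>; thus \<open>D\<close> witnesses that \<open>U\<close> is an \<open>R\<close>-set, and a countable \<open>\<pi>\<close>-base consists of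
  \<open>R\<close>-sets. Complete regularity and density make \<open>D\<close> separate points, so \<open>D\<close> maps \<open>X\<close>
  injectively and continuously into \<open>\<real>\<^sup>\<nat>\<close>, whose metric pulls back to a coarser metric on \<open>X\<close>.

  The substantial direction starts from three countable sets of continuous functions. A coarser
  metric together with a countable dense set gives a family separating points (the distances to the
  points of the dense set); the \<open>\<pi>\<close>-base gives bump functions that are \<open>1\<close> on a nonempty open
  subset of any given open set and \<open>0\<close> outside (\<open>countable_bump_family\<close>);
  \<open>R\<close>-separability gives, after truncation between rationals, functions that stay within \<open>\<epsilon>\<close> of \<open>r\<close>
  everywhere but take the value \<open>r\<close> exactly somewhere in a given open set
  (\<open>countable_level_family\<close>). Let \<open>D\<close> be the closure of the rational affine images of the
  separating family under maximum, minimum, and gluing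
  \<open>g \<mapsto> (1 - \<psi>) g + \<psi> h\<close> with a bump \<open>\<psi>\<close> and a level function \<open>h\<close>. It is countable. By the lattice form of
  the Stone-Weierstrass theorem, \<open>D\<close> approximates every continuous \<open>f\<close> uniformly on every compact
  set. The equations \<open>g y = f s\<close> with \<open>y\<close> near \<open>s\<close>, which approximation cannot provide, are
  then obtained one at a time by gluing: at points of the compact set near \<open>s\<close> both \<open>g\<close> and the level function
  approximate \<open>f\<close>, hence so does their convex combination, and the bump avoids the finitely many points
  where earlier equations hold because nonempty open sets are uncountable.
\<close>

section \<open>Continuous functions and the topologies on them\<close>

lemma restrict_in_cont_funs:
  assumes "continuous_map X euclideanreal f"
  shows "restrict f (topspace X) \<in> cont_funs X"
proof -
  have "continuous_map X euclideanreal (restrict f (topspace X))"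
    by (rule continuous_map_eq[OF assms]) auto
  then show ?thesis
    by (auto simp: cont_funs_def)
qed

lemma cont_funs_continuous: "f \<in> cont_funs X \<Longrightarrow> continuous_map X euclideanreal f"
  by (simp add: cont_funs_def)

lemma topspace_C_kh: "topspace (C_kh X) = cont_funs X"
  unfolding C_kh_def topology_generated_by_topspace by (auto simp: plus_set_def minus_set_def)

lemma topspace_C_ph: "topspace (C_ph X) = cont_funs X"
  unfolding C_ph_def topology_generated_by_topspace by (auto simp: plus_set_def minus_set_def)

lemma openin_C_ph_imp_C_kh:
  assumes "openin (C_ph X) O'"
  shows "openin (C_kh X) O'"
proof -
  have "generate_topology_on (insert (cont_funs X)
     ({plus_set X {x} V | x V. x \<in> topspace X \<and> open V} \<union>
      {minus_set X U r | U r. openin X U})) O'"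
    using assms by (simp add: C_ph_def openin_topology_generated_by_iff)
  then show ?thesis
  proof (induction rule: generate_topology_on.induct)
    case (Basis s)
    have "compactin X {x}" if "x \<in> topspace X" for x
      using that by (simp add: finite_imp_compactin)
    with Basis have "s \<in> insert (cont_funs X) ({plus_set X A V | A V. compactin X A \<and> open V} \<union>
        {minus_set X U r | U r. openin X U})"
      by blast
    then show ?case
      unfolding C_kh_def by (rule topology_generated_by_Basis)
  qed auto
qed

lemma openin_C_ph_plus_set:
  "x \<in> topspace X \<Longrightarrow> open V \<Longrightarrow> openin (C_ph X) (plus_set X {x} V)"
  unfolding C_ph_def by (rule topology_generated_by_Basis) blast

lemma openin_C_ph_minus_set: "openin X U \<Longrightarrow> openin (C_ph X) (minus_set X U r)"
  unfolding C_ph_def by (rule topology_generated_by_Basis) blast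

text \<open>
  Neighbourhoods in \<open>C_kh X\<close> contain ones described by a single compact set, a single tolerance and
  finitely many equations near prescribed points. Taking \<open>U\<close> to be a neighbourhood of every point
  of the space, and not just of those in \<open>S\<close>, lets two such data be intersected pointwise.
\<close>

lemma C_kh_neighbourhood:
  assumes "openin (C_kh X) O'" "f \<in> O'"
  shows "\<exists>A \<epsilon> S U. compactin X A \<and> 0 < \<epsilon> \<and> finite S \<and> S \<subseteq> topspace X \<and>
    (\<forall>s\<in>topspace X. openin X (U s) \<and> s \<in> U s) \<and>
    (\<forall>g\<in>cont_funs X. (\<forall>x\<in>A. \<bar>g x - f x\<bar> < \<epsilon>) \<and> (\<forall>s\<in>S. \<exists>y\<in>U s. g y = f s) \<longrightarrow> g \<in> O')"
    (is "?N O'")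
proof -
  have "generate_topology_on (insert (cont_funs X)
     ({plus_set X A V | A V. compactin X A \<and> open V} \<union>
      {minus_set X U r | U r. openin X U})) O'"
    using assms by (simp add: C_kh_def openin_topology_generated_by_iff)
  then show ?thesis
    using assms(2)
  proof (induction rule: generate_topology_on.induct)
    case Empty
    then show ?case by simp
  next
    case (Int a b)
    from Int.IH(1) Int.prems obtain A \<epsilon> S U where 1: "compactin X A" "0 < \<epsilon>" "finite S" "S \<subseteq> topspace X"
        "\<forall>s\<in>topspace X. openin X (U s) \<and> s \<in> U s"
        "\<forall>g\<in>cont_funs X. (\<forall>x\<in>A. \<bar>g x - f x\<bar> < \<epsilon>) \<and> (\<forall>s\<in>S. \<exists>y\<in>U s. g y = f s) \<longrightarrow> g \<in> a"
      by blast
    from Int.IH(2) Int.prems obtain A' \<epsilon>' S' U' where 2: "compactin X A'" "0 < \<epsilon>'" "finite S'" "S' \<subseteq> topspace X"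
        "\<forall>s\<in>topspace X. openin X (U' s) \<and> s \<in> U' s"
        "\<forall>g\<in>cont_funs X. (\<forall>x\<in>A'. \<bar>g x - f x\<bar> < \<epsilon>') \<and> (\<forall>s\<in>S'. \<exists>y\<in>U' s. g y = f s) \<longrightarrow> g \<in> b"
      by blast
    have "g \<in> a \<inter> b" if "g \<in> cont_funs X" "\<forall>x\<in>A \<union> A'. \<bar>g x - f x\<bar> < min \<epsilon> \<epsilon>'"
        "\<forall>s\<in>S \<union> S'. \<exists>y\<in>U s \<inter> U' s. g y = f s" for g
    proof -
      have "(\<forall>x\<in>A. \<bar>g x - f x\<bar> < \<epsilon>) \<and> (\<forall>s\<in>S. \<exists>y\<in>U s. g y = f s)"
        using that(2,3) by (meson IntE UnI1 min_less_iff_conj)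
      moreover have "(\<forall>x\<in>A'. \<bar>g x - f x\<bar> < \<epsilon>') \<and> (\<forall>s\<in>S'. \<exists>y\<in>U' s. g y = f s)"
        using that(2,3) by (meson IntE UnI2 min_less_iff_conj)
      ultimately show ?thesis using 1(6) 2(6) that(1) by blast
    qed
    then show ?case
      using 1(1-5) 2(1-5)
      by (intro exI[of _ "A \<union> A'"] exI[of _ "min \<epsilon> \<epsilon>'"] exI[of _ "S \<union> S'"] exI[of _ "\<lambda>s. U s \<inter> U' s"])
         (auto simp: compactin_Un)
  next
    case (UN K)
    then obtain k where k: "k \<in> K" "f \<in> k" by auto
    from UN.IH[OF k] obtain A \<epsilon> S U where "compactin X A" "0 < \<epsilon>" "finite S" "S \<subseteq> topspace X"
        "\<forall>s\<in>topspace X. openin X (U s) \<and> s \<in> U s"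
        "\<forall>g\<in>cont_funs X. (\<forall>x\<in>A. \<bar>g x - f x\<bar> < \<epsilon>) \<and> (\<forall>s\<in>S. \<exists>y\<in>U s. g y = f s) \<longrightarrow> g \<in> k"
      by blast
    then show ?case
      using k(1) by (intro exI[of _ A] exI[of _ \<epsilon>] exI[of _ S] exI[of _ U]) auto
  next
    case (Basis s)
    then consider "s = cont_funs X"
      | A V where "s = plus_set X A V" "compactin X A" "open V"
      | U r where "s = minus_set X U r" "openin X U"
      by blast
    then show ?case
    proof cases
      case 1
      then show ?thesis
        by (intro exI[of _ "{}"] exI[of _ 1] exI[of _ "\<lambda>_. topspace X"]) auto
    next
      case 2
      have f: "f \<in> cont_funs X" "f ` A \<subseteq> V"
        using Basis.prems 2 by (auto simp: plus_set_def)
      have "compact (f ` A)"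
        using image_compactin[OF 2(2) cont_funs_continuous[OF f(1)]] by simp
      then obtain \<epsilon> where \<epsilon>: "\<epsilon> > 0" "(\<Union>x\<in>f ` A. ball x \<epsilon>) \<subseteq> V"
        using compact_subset_open_imp_ball_epsilon_subset 2(3) f(2) by metis
      have "g \<in> s" if "g \<in> cont_funs X" "\<forall>x\<in>A. \<bar>g x - f x\<bar> < \<epsilon>" for g
      proof -
        have "g x \<in> V" if "x \<in> A" for x
        proof -
          have "g x \<in> ball (f x) \<epsilon>"
            using \<open>\<forall>x\<in>A. \<bar>g x - f x\<bar> < \<epsilon>\<close> \<open>x \<in> A\<close> by (auto simp: dist_real_def abs_minus_commute)
          then show ?thesis using \<epsilon>(2) \<open>x \<in> A\<close> by blast
        qed
        then show ?thesis using 2(1) \<open>g \<in> cont_funs X\<close> by (auto simp: plus_set_def)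
      qed
      then show ?thesis
        using 2(2) \<epsilon>(1)
        by (intro exI[of _ A] exI[of _ \<epsilon>] exI[of _ "{}"] exI[of _ "\<lambda>_. topspace X"]) auto
    next
      case 3
      then obtain y where y: "y \<in> U" "f y = r"
        using Basis.prems by (auto simp: minus_set_def)
      have "y \<in> topspace X" using y 3 openin_subset by blast
      then show ?thesis
        using 3 y
        by (intro exI[of _ "{}"] exI[of _ 1] exI[of _ "{y}"]
              exI[of _ "\<lambda>s. if s = y then U else topspace X"]) (auto simp: minus_set_def)
    qed
  qed
qed

section \<open>Submetrizability and point-separating families\<close>

definition separates_points :: "'a topology \<Rightarrow> ('a \<Rightarrow> real) set \<Rightarrow> bool" where
  "separates_points X F \<longleftrightarrow> (\<forall>x\<in>topspace X. \<forall>y\<in>topspace X. x \<noteq> y \<longrightarrow> (\<exists>f\<in>F. f x \<noteq> f y))"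

text \<open>
  A countable separating family is an injection into \<open>\<real>\<^sup>\<nat>\<close>; the metric of that space pulls back.
\<close>

lemma submetrizable_if_separates_points:
  assumes "countable F" "F \<subseteq> cont_funs X" "separates_points X F"
  shows "submetrizable_space X"
proof -
  \<comment> \<open>Adding one more function keeps the family nonempty, so that a sequence can enumerate it.\<close>
  define F' where "F' = insert (restrict (\<lambda>_. 0) (topspace X)) F"
  define \<phi> where "\<phi> = from_nat_into F'"
  have rng: "range \<phi> = F'"
    unfolding \<phi>_def using assms(1) by (intro range_from_nat_into) (auto simp: F'_def)
  have \<phi>c: "continuous_map X euclideanreal (\<phi> n)" for n
  proof -
    have "F' \<subseteq> cont_funs X"
      using assms(2) restrict_in_cont_funs[of X "\<lambda>_. 0"] by (auto simp: F'_def)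
    then show ?thesis using rng cont_funs_continuous by blast
  qed
  define \<Phi> :: "'a \<Rightarrow> nat \<Rightarrow> real" where "\<Phi> x = (\<lambda>n. \<phi> n x)" for x
  have \<Phi>c: "continuous_map X euclidean \<Phi>"
    unfolding euclidean_product_topology[symmetric] continuous_map_componentwise_UNIV \<Phi>_def
    using \<phi>c by simp
  have \<Phi>i: "\<Phi> x \<noteq> \<Phi> y" if "x \<in> topspace X" "y \<in> topspace X" "x \<noteq> y" for x y
  proof -
    obtain f where "f \<in> F" "f x \<noteq> f y"
      using assms(3) \<open>x \<in> topspace X\<close> \<open>y \<in> topspace X\<close> \<open>x \<noteq> y\<close>
      unfolding separates_points_def by meson
    moreover from \<open>f \<in> F\<close> obtain n where "f = \<phi> n" using rng unfolding F'_def by blast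
    ultimately show ?thesis unfolding \<Phi>_def by metis
  qed
  interpret M: Metric_space "topspace X" "\<lambda>x y. dist (\<Phi> x) (\<Phi> y)"
    by unfold_locales (use \<Phi>i in \<open>auto simp: dist_commute dist_triangle\<close>)
  have "openin X U" if U: "openin M.mtopology U" for U
  proof (subst openin_subopen, intro ballI)
    fix x assume x: "x \<in> U"
    obtain r where r: "r > 0" "M.mball x r \<subseteq> U" and xt: "x \<in> topspace X"
      using U x unfolding M.openin_mtopology by blast
    have "openin X {y \<in> topspace X. \<Phi> y \<in> ball (\<Phi> x) r}"
      using openin_continuous_map_preimage[OF \<Phi>c, of "ball (\<Phi> x) r"] by simp
    moreover have "{y \<in> topspace X. \<Phi> y \<in> ball (\<Phi> x) r} \<subseteq> U"
      using r(2) xt by (auto simp: subset_iff)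
    ultimately show "\<exists>T. openin X T \<and> x \<in> T \<and> T \<subseteq> U"
      using r(1) xt by (intro exI[of _ "{y \<in> topspace X. \<Phi> y \<in> ball (\<Phi> x) r}"]) auto
  qed
  then show ?thesis
    unfolding submetrizable_space_def
    using M.metrizable_space_mtopology M.topspace_mtopology by blast
qed

lemma separable_if_countable_pi_base:
  assumes "countable \<P>" "pi_base X \<P>"
  shows "separable_space X"
proof -
  define c where "c P = (SOME x. x \<in> P)" for P :: "'a set"
  have c: "c P \<in> P" if "P \<in> \<P>" for P
    using assms(2) that some_in_eq unfolding pi_base_def c_def by blast
  have "X closure_of (c ` \<P>) = topspace X"
    unfolding dense_intersects_open
  proof (intro allI impI)
    fix T assume "openin X T \<and> T \<noteq> {}"
    then obtain P where "P \<in> \<P>" "P \<subseteq> T"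
      using assms(2) unfolding pi_base_def by meson
    then show "c ` \<P> \<inter> T \<noteq> {}" using c by blast
  qed
  moreover have "c ` \<P> \<subseteq> topspace X"
  proof (rule image_subsetI)
    fix P assume P: "P \<in> \<P>"
    then have "openin X P" using assms(2) unfolding pi_base_def by simp
    then have "P \<subseteq> topspace X" by (rule openin_subset)
    then show "c P \<in> topspace X" using c[OF P] by (rule subsetD)
  qed
  ultimately show ?thesis
    using assms(1) unfolding separable_space_def by blast
qed

text \<open>
  A dense set of \<open>X\<close> stays dense in a coarser topology, so the distances to its points determine a
  point.
\<close>

lemma countable_separating_family:
  assumes "submetrizable_space X" "separable_space X"
  shows "\<exists>F. countable F \<and> F \<subseteq> cont_funs X \<and> separates_points X F"
proof -
  obtain M d where ms: "Metric_space M d"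
    and top: "M = topspace X" and coarse: "\<And>U. openin (Metric_space.mtopology M d) U \<Longrightarrow> openin X U"
    using assms(1) Metric_space.topspace_mtopology
    unfolding submetrizable_space_def metrizable_space_def by metis
  interpret Metric_space M d by (rule ms)
  obtain C where C: "countable C" "C \<subseteq> topspace X" "X closure_of C = topspace X"
    using assms(2) unfolding separable_space_def by blast
  have idc: "continuous_map X mtopology id"
  proof -
    have "{x \<in> topspace X. id x \<in> U} = U" if "openin mtopology U" for U
      using openin_subset[OF coarse[OF that]] by auto
    then show ?thesis
      unfolding continuous_map_def using coarse top topspace_mtopology by simp
  qed
  have dc: "continuous_map X euclideanreal (\<lambda>x. d x c)" if "c \<in> M" for c
    using continuous_map_mdist[of X Self id "\<lambda>_. c"] idc that
    by (simp add: mtopology_of_def)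
  define F where "F = (\<lambda>c. restrict (\<lambda>x. d x c) (topspace X)) ` C"
  have "F \<subseteq> cont_funs X"
    unfolding F_def using C(2) top dc restrict_in_cont_funs by blast
  moreover have "separates_points X F"
    unfolding separates_points_def
  proof (intro ballI impI)
    fix x y assume xy: "x \<in> topspace X" "y \<in> topspace X" "x \<noteq> y"
    have "openin X (mball x (d x y / 2))"
      using coarse openin_mball by blast
    moreover have "x \<in> mball x (d x y / 2)"
      unfolding centre_in_mball_iff using xy mdist_pos_less unfolding top by simp
    ultimately have "C \<inter> mball x (d x y / 2) \<noteq> {}"
      using C(3) unfolding dense_intersects_open by blast
    then obtain c where c: "c \<in> C" "c \<in> mball x (d x y / 2)"
      by blast
    have "d x c \<noteq> d y c"
      using c(2) xy triangle[of x c y] commute[of c y] unfolding in_mball unfolding top by auto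
    then show "\<exists>f\<in>F. f x \<noteq> f y"
      unfolding F_def using c(1) xy by auto
  qed
  moreover have "countable F" unfolding F_def using C(1) by simp
  ultimately show ?thesis by blast
qed

section \<open>Countable families of local functions\<close>

definition bump_family :: "'a topology \<Rightarrow> ('a \<Rightarrow> real) set \<Rightarrow> bool" where
  "bump_family X \<Psi> \<longleftrightarrow> \<Psi> \<subseteq> cont_funs X \<and> (\<forall>\<psi>\<in>\<Psi>. \<forall>x\<in>topspace X. 0 \<le> \<psi> x \<and> \<psi> x \<le> 1) \<and>
    (\<forall>W. openin X W \<and> W \<noteq> {} \<longrightarrow>
      (\<exists>\<psi>\<in>\<Psi>. \<exists>Q. openin X Q \<and> Q \<noteq> {} \<and> Q \<subseteq> W \<and>
        (\<forall>x\<in>Q. \<psi> x = 1) \<and> (\<forall>x\<in>topspace X - W. \<psi> x = 0)))"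

definition level_family :: "'a topology \<Rightarrow> ('a \<Rightarrow> real) set \<Rightarrow> bool" where
  "level_family X H \<longleftrightarrow> H \<subseteq> cont_funs X \<and>
    (\<forall>Q r \<epsilon>. openin X Q \<and> Q \<noteq> {} \<and> 0 < \<epsilon> \<longrightarrow>
      (\<exists>h\<in>H. (\<forall>x\<in>topspace X. \<bar>h x - r\<bar> < \<epsilon>) \<and> (\<exists>y\<in>Q. h y = r)))"

text \<open>
  Doubling and truncating a function that separates a point from a closed set makes it constantly
  \<open>1\<close> on a neighbourhood of the point.
\<close>

lemma bump_function:
  assumes "completely_regular_space X" "openin X P" "P \<noteq> {}"
  shows "\<exists>\<psi>\<in>cont_funs X. (\<forall>x\<in>topspace X. 0 \<le> \<psi> x \<and> \<psi> x \<le> 1) \<and>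
    (\<exists>Q. openin X Q \<and> Q \<noteq> {} \<and> Q \<subseteq> P \<and> (\<forall>x\<in>Q. \<psi> x = 1) \<and> (\<forall>x\<in>topspace X - P. \<psi> x = 0))"
proof -
  obtain p where p: "p \<in> P" "p \<in> topspace X"
    using assms(2,3) openin_subset by blast
  then have "closedin X (topspace X - P) \<and> p \<in> topspace X - (topspace X - P)"
    using assms(2) by auto
  then obtain f :: "'a \<Rightarrow> real" where f: "continuous_map X (top_of_set {0..1}) f" "f p = 0"
      "f ` (topspace X - P) \<subseteq> {1}"
    using assms(1) unfolding completely_regular_space_def by meson
  have fc: "continuous_map X euclideanreal f" and f01: "\<And>x. x \<in> topspace X \<Longrightarrow> 0 \<le> f x \<and> f x \<le> 1"
    using f(1) by (auto simp: continuous_map_in_subtopology)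
  define \<psi> where "\<psi> = restrict (\<lambda>x. min 1 (2 * (1 - f x))) (topspace X)"
  have "continuous_map X euclideanreal (\<lambda>x. min 1 (2 * (1 - f x)))"
    using fc by (intro continuous_intros) auto
  then have "\<psi> \<in> cont_funs X" unfolding \<psi>_def by (rule restrict_in_cont_funs)
  moreover have "\<forall>x\<in>topspace X. 0 \<le> \<psi> x \<and> \<psi> x \<le> 1"
    using f01 by (auto simp: \<psi>_def)
  moreover define Q where "Q = {x \<in> topspace X. f x \<in> {..<1/2}}"
  have "openin X Q"
    unfolding Q_def by (rule openin_continuous_map_preimage[OF fc]) simp
  moreover have "Q \<noteq> {}" using p f(2) by (auto simp: Q_def)
  moreover have "Q \<subseteq> P" using f(3) by (force simp: Q_def)
  moreover have "\<forall>x\<in>Q. \<psi> x = 1" by (auto simp: Q_def \<psi>_def)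
  moreover have "\<forall>x\<in>topspace X - P. \<psi> x = 0" using f(3) by (auto simp: \<psi>_def)
  ultimately show ?thesis by (intro bexI[of _ \<psi>] conjI exI[of _ Q])
qed

lemma countable_bump_family:
  assumes "completely_regular_space X" "countable \<P>" "pi_base X \<P>"
  shows "\<exists>\<Psi>. countable \<Psi> \<and> bump_family X \<Psi>"
proof -
  have "\<forall>P\<in>\<P>. \<exists>\<psi>. \<psi> \<in> cont_funs X \<and> (\<forall>x\<in>topspace X. 0 \<le> \<psi> x \<and> \<psi> x \<le> 1) \<and>
    (\<exists>Q. openin X Q \<and> Q \<noteq> {} \<and> Q \<subseteq> P \<and> (\<forall>x\<in>Q. \<psi> x = 1) \<and> (\<forall>x\<in>topspace X - P. \<psi> x = 0))"
  proof
    fix P assume "P \<in> \<P>"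
    then have "openin X P" "P \<noteq> {}" using assms(3) unfolding pi_base_def by auto
    from bump_function[OF assms(1) this]
    show "\<exists>\<psi>. \<psi> \<in> cont_funs X \<and> (\<forall>x\<in>topspace X. 0 \<le> \<psi> x \<and> \<psi> x \<le> 1) \<and>
      (\<exists>Q. openin X Q \<and> Q \<noteq> {} \<and> Q \<subseteq> P \<and> (\<forall>x\<in>Q. \<psi> x = 1) \<and> (\<forall>x\<in>topspace X - P. \<psi> x = 0))"
      unfolding Bex_def .
  qed
  from bchoice[OF this] obtain b where b: "\<And>P. P \<in> \<P> \<Longrightarrow> b P \<in> cont_funs X \<and> (\<forall>x\<in>topspace X. 0 \<le> b P x \<and> b P x \<le> 1) \<and>
    (\<exists>Q. openin X Q \<and> Q \<noteq> {} \<and> Q \<subseteq> P \<and> (\<forall>x\<in>Q. b P x = 1) \<and> (\<forall>x\<in>topspace X - P. b P x = 0))"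
    by blast
  have "\<exists>\<psi>\<in>b ` \<P>. \<exists>Q. openin X Q \<and> Q \<noteq> {} \<and> Q \<subseteq> W \<and>
        (\<forall>x\<in>Q. \<psi> x = 1) \<and> (\<forall>x\<in>topspace X - W. \<psi> x = 0)" if W: "openin X W" "W \<noteq> {}" for W
  proof -
    obtain P where P: "P \<in> \<P>" "P \<subseteq> W"
      using assms(3) W unfolding pi_base_def by meson
    obtain Q where "openin X Q" "Q \<noteq> {}" "Q \<subseteq> P" "\<forall>x\<in>Q. b P x = 1" "\<forall>x\<in>topspace X - P. b P x = 0"
      using b[OF P(1)] by blast
    then show ?thesis using P by (intro bexI[of _ "b P"] exI[of _ Q]) auto
  qed
  then have "bump_family X (b ` \<P>)"
    unfolding bump_family_def using b by auto
  then show ?thesis using assms(2) by blast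
qed

text \<open>
  If \<open>f\<close> takes the value \<open>r\<close> somewhere, so does its truncation between rationals \<open>a < r < b\<close>, and the
  truncation is close to \<open>r\<close> everywhere. Only countably many truncations arise from the countably
  many functions that witness \<open>R\<close>-separability.
\<close>

lemma countable_level_family:
  assumes "R_separable X"
  shows "\<exists>H. countable H \<and> level_family X H"
proof -
  obtain \<B> where \<B>: "countable \<B>" "\<forall>B\<in>\<B>. R_set X B"
      "\<forall>U. openin X U \<and> U \<noteq> {} \<longrightarrow> (\<exists>B\<in>\<B>. B \<subseteq> U)"
    using assms unfolding R_separable_def by (elim exE conjE) (rule that)
  have "\<forall>B\<in>\<B>. \<exists>f :: nat \<Rightarrow> 'a \<Rightarrow> real. (\<forall>n. f n \<in> cont_funs X) \<and> (\<Union>n. f n ` B) = UNIV"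
    using \<B>(2) unfolding R_set_def by simp
  from bchoice[OF this] obtain F :: "'a set \<Rightarrow> nat \<Rightarrow> 'a \<Rightarrow> real" where
    Fall: "\<forall>B\<in>\<B>. (\<forall>n. F B n \<in> cont_funs X) \<and> (\<Union>n. F B n ` B) = UNIV"
    by (elim exE) (rule that)
  have F: "\<And>B n. B \<in> \<B> \<Longrightarrow> F B n \<in> cont_funs X" "\<And>B. B \<in> \<B> \<Longrightarrow> (\<Union>n. F B n ` B) = UNIV"
    using Fall by simp_all
  define t where "t = (\<lambda>(B, n, a, b). restrict (\<lambda>x. max a (min (F B n x) b)) (topspace X))"
  define H where "H = t ` (\<B> \<times> UNIV \<times> \<rat> \<times> \<rat>)"
  have "countable H"
    unfolding H_def using \<B>(1) countable_rat by (intro countable_image countable_SIGMA) auto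
  moreover have "H \<subseteq> cont_funs X"
    unfolding H_def t_def using cont_funs_continuous[OF F(1)]
    by (auto intro!: restrict_in_cont_funs continuous_map_real_max continuous_map_real_min)
  moreover have "\<exists>h\<in>H. (\<forall>x\<in>topspace X. \<bar>h x - r\<bar> < \<epsilon>) \<and> (\<exists>y\<in>Q. h y = r)"
    if Q: "openin X Q" "Q \<noteq> {}" "0 < \<epsilon>" for Q r \<epsilon>
  proof -
    obtain B where B: "B \<in> \<B>" "B \<subseteq> Q" using \<B>(3) Q by blast
    have "r \<in> (\<Union>n. F B n ` B)" using F(2)[OF B(1)] by simp
    then obtain n y where y: "y \<in> B" "F B n y = r" by auto
    obtain a where a: "a \<in> \<rat>" "r - \<epsilon> < a" "a < r" using Rats_dense_in_real[of "r - \<epsilon>" r] Q(3) by auto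
    obtain b where b: "b \<in> \<rat>" "r < b" "b < r + \<epsilon>" using Rats_dense_in_real[of r "r + \<epsilon>"] Q(3) by auto
    have "y \<in> topspace X" using y B Q openin_subset by blast
    then have "t (B, n, a, b) y = r" using y a b by (simp add: t_def)
    moreover have "\<forall>x\<in>topspace X. \<bar>t (B, n, a, b) x - r\<bar> < \<epsilon>"
      using a b by (auto simp: t_def max_def min_def)
    moreover have "t (B, n, a, b) \<in> H" unfolding H_def using B a b by blast
    ultimately show ?thesis using y B by blast
  qed
  ultimately show ?thesis unfolding level_family_def by (intro exI[of _ H]) simp
qed

text \<open>
  Countably many functions exhaust the reals on every nonempty open set, which therefore cannot be
  countable.
\<close>

lemma level_family_imp_uncountable_open:
  assumes "countable H" "level_family X H" "openin X W" "W \<noteq> {}"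
  shows "uncountable W"
proof
  assume "countable W"
  then have "countable (\<Union>h\<in>H. h ` W)" using assms(1) by auto
  moreover have "(\<Union>h\<in>H. h ` W) = UNIV"
  proof -
    have "\<exists>h\<in>H. \<exists>y\<in>W. r = h y" for r
    proof -
      have "\<exists>h\<in>H. (\<forall>x\<in>topspace X. \<bar>h x - r\<bar> < 1) \<and> (\<exists>y\<in>W. h y = r)"
        using assms(2-4) unfolding level_family_def by simp
      then show ?thesis by auto
    qed
    then show ?thesis by (simp add: set_eq_iff image_iff)
  qed
  ultimately show False using uncountable_UNIV_real by simp
qed

section \<open>Uniform approximation on compact sets\<close>

lemma compactin_induct:
  assumes "compactin X A" and empty: "Q {}"
    and Un: "\<And>S T. Q S \<Longrightarrow> Q T \<Longrightarrow> Q (S \<union> T)" and mono: "\<And>S T. S \<subseteq> T \<Longrightarrow> Q T \<Longrightarrow> Q S"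
    and loc: "\<And>x. x \<in> A \<Longrightarrow> \<exists>U. openin X U \<and> x \<in> U \<and> Q U"
  shows "Q A"
proof -
  have "(\<forall>U\<in>{U. openin X U \<and> Q U}. openin X U) \<and> A \<subseteq> \<Union>{U. openin X U \<and> Q U}"
    using loc by blast
  then obtain \<F> where \<F>: "finite \<F>" "\<F> \<subseteq> {U. openin X U \<and> Q U}" "A \<subseteq> \<Union>\<F>"
    using assms(1) unfolding compactin_def by meson
  from \<F>(1,2) have "Q (\<Union>\<F>)"
    by (induction rule: finite_induct) (auto intro: empty Un)
  then show ?thesis using mono \<F>(3) by blast
qed

text \<open>
  The lattice form of the Stone-Weierstrass theorem. For fixed \<open>x\<close>, minima of finitely many functions
  that interpolate \<open>f\<close> approximately at \<open>x\<close> and another point bound \<open>f\<close> from above on \<open>A\<close> while staying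
  close to it at \<open>x\<close>; a finite maximum of these over several \<open>x\<close> is close to \<open>f\<close> on \<open>A\<close>.
\<close>

lemma lattice_approximation:
  fixes f :: "'a \<Rightarrow> real"
  assumes A: "compactin X A" and ne: "L \<noteq> {}"
    and cont: "\<And>g. g \<in> L \<Longrightarrow> continuous_map X euclideanreal g"
    and max: "\<And>g h. g \<in> L \<Longrightarrow> h \<in> L \<Longrightarrow> \<exists>k\<in>L. \<forall>x\<in>A. k x = max (g x) (h x)"
    and min: "\<And>g h. g \<in> L \<Longrightarrow> h \<in> L \<Longrightarrow> \<exists>k\<in>L. \<forall>x\<in>A. k x = min (g x) (h x)"
    and f: "continuous_map X euclideanreal f"
    and two: "\<And>x y. x \<in> A \<Longrightarrow> y \<in> A \<Longrightarrow> \<exists>g\<in>L. \<bar>g x - f x\<bar> < \<epsilon> \<and> \<bar>g y - f y\<bar> < \<epsilon>"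
  shows "\<exists>g\<in>L. \<forall>x\<in>A. \<bar>g x - f x\<bar> < \<epsilon>"
proof (cases "A = {}")
  case True
  then show ?thesis using ne by blast
next
  case False
  have At: "A \<subseteq> topspace X" using A by (rule compactin_subset_topspace)
  have opn: "openin X {z \<in> topspace X. g z - f z \<in> V}" if "g \<in> L" "open V" for g V
    by (rule openin_continuous_map_preimage[of X euclideanreal "\<lambda>z. g z - f z"])
       (use that cont f in \<open>auto intro: continuous_map_diff\<close>)
  have above: "\<exists>g\<in>L. f x - \<epsilon> < g x \<and> (\<forall>z\<in>A \<inter> A. g z < f z + \<epsilon>)" if x: "x \<in> A" for x
  proof (rule compactin_induct[OF A, where Q = "\<lambda>S. \<exists>g\<in>L. f x - \<epsilon> < g x \<and> (\<forall>z\<in>A \<inter> S. g z < f z + \<epsilon>)"])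
    show "\<exists>g\<in>L. f x - \<epsilon> < g x \<and> (\<forall>z\<in>A \<inter> {}. g z < f z + \<epsilon>)"
    proof -
      obtain g where "g \<in> L" "\<bar>g x - f x\<bar> < \<epsilon>" using two[OF x x] by blast
      then show ?thesis by (intro bexI[of _ g]) auto
    qed
  next
    fix S T
    assume "\<exists>g\<in>L. f x - \<epsilon> < g x \<and> (\<forall>z\<in>A \<inter> S. g z < f z + \<epsilon>)"
      and "\<exists>g\<in>L. f x - \<epsilon> < g x \<and> (\<forall>z\<in>A \<inter> T. g z < f z + \<epsilon>)"
    then obtain g h where gh: "g \<in> L" "f x - \<epsilon> < g x" "\<forall>z\<in>A \<inter> S. g z < f z + \<epsilon>"
        "h \<in> L" "f x - \<epsilon> < h x" "\<forall>z\<in>A \<inter> T. h z < f z + \<epsilon>"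
      by (elim bexE conjE) (rule that)
    from min[OF gh(1,4)] obtain k where k: "k \<in> L" "\<forall>x\<in>A. k x = Orderings.min (g x) (h x)"
      by (rule bexE)
    have "f x - \<epsilon> < k x" using gh k x by simp
    moreover have "\<forall>z\<in>A \<inter> (S \<union> T). k z < f z + \<epsilon>" using gh k by (auto simp: min_less_iff_disj)
    ultimately show "\<exists>g\<in>L. f x - \<epsilon> < g x \<and> (\<forall>z\<in>A \<inter> (S \<union> T). g z < f z + \<epsilon>)"
      using k(1) by (intro bexI[of _ k] conjI)
  next
    fix y assume y: "y \<in> A"
    obtain g where g: "g \<in> L" "\<bar>g x - f x\<bar> < \<epsilon>" "\<bar>g y - f y\<bar> < \<epsilon>"
      using two[OF x y] by (elim bexE conjE) (rule that)
    have "openin X {z \<in> topspace X. g z - f z \<in> {..<\<epsilon>}}" by (rule opn[OF g(1)]) simp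
    moreover have "y \<in> {z \<in> topspace X. g z - f z \<in> {..<\<epsilon>}}" using y g At by auto
    ultimately show "\<exists>U. openin X U \<and> y \<in> U \<and> (\<exists>g\<in>L. f x - \<epsilon> < g x \<and> (\<forall>z\<in>A \<inter> U. g z < f z + \<epsilon>))"
      using g
      by (intro exI[of _ "{z \<in> topspace X. g z - f z \<in> {..<\<epsilon>}}"] conjI bexI[of _ g]) auto
  qed blast
  have "\<exists>g\<in>L. (\<forall>z\<in>A. g z < f z + \<epsilon>) \<and> (\<forall>z\<in>A \<inter> A. f z - \<epsilon> < g z)"
  proof (rule compactin_induct[OF A, where Q = "\<lambda>S. \<exists>g\<in>L. (\<forall>z\<in>A. g z < f z + \<epsilon>) \<and> (\<forall>z\<in>A \<inter> S. f z - \<epsilon> < g z)"])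
    show "\<exists>g\<in>L. (\<forall>z\<in>A. g z < f z + \<epsilon>) \<and> (\<forall>z\<in>A \<inter> {}. f z - \<epsilon> < g z)"
      using above False by fastforce
  next
    fix S T
    assume "\<exists>g\<in>L. (\<forall>z\<in>A. g z < f z + \<epsilon>) \<and> (\<forall>z\<in>A \<inter> S. f z - \<epsilon> < g z)"
      and "\<exists>g\<in>L. (\<forall>z\<in>A. g z < f z + \<epsilon>) \<and> (\<forall>z\<in>A \<inter> T. f z - \<epsilon> < g z)"
    then obtain g h where gh: "g \<in> L" "\<forall>z\<in>A. g z < f z + \<epsilon>" "\<forall>z\<in>A \<inter> S. f z - \<epsilon> < g z"
        "h \<in> L" "\<forall>z\<in>A. h z < f z + \<epsilon>" "\<forall>z\<in>A \<inter> T. f z - \<epsilon> < h z"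
      by (elim bexE conjE) (rule that)
    from max[OF gh(1,4)] obtain k where k: "k \<in> L" "\<forall>x\<in>A. k x = Orderings.max (g x) (h x)"
      by (rule bexE)
    have "\<forall>z\<in>A. k z < f z + \<epsilon>" using gh k by simp
    moreover have "\<forall>z\<in>A \<inter> (S \<union> T). f z - \<epsilon> < k z" using gh k by (auto simp: less_max_iff_disj)
    ultimately show "\<exists>g\<in>L. (\<forall>z\<in>A. g z < f z + \<epsilon>) \<and> (\<forall>z\<in>A \<inter> (S \<union> T). f z - \<epsilon> < g z)"
      using k(1) by (intro bexI[of _ k] conjI)
  next
    fix x assume x: "x \<in> A"
    obtain g where g: "g \<in> L" "f x - \<epsilon> < g x" "\<forall>z\<in>A. g z < f z + \<epsilon>" using above[OF x] by auto
    have "openin X {z \<in> topspace X. g z - f z \<in> {-\<epsilon><..}}" by (rule opn[OF g(1)]) simp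
    moreover have "x \<in> {z \<in> topspace X. g z - f z \<in> {-\<epsilon><..}}" using x g At by auto
    ultimately show "\<exists>U. openin X U \<and> x \<in> U \<and>
        (\<exists>g\<in>L. (\<forall>z\<in>A. g z < f z + \<epsilon>) \<and> (\<forall>z\<in>A \<inter> U. f z - \<epsilon> < g z))"
      using g
      by (intro exI[of _ "{z \<in> topspace X. g z - f z \<in> {-\<epsilon><..}}"] conjI bexI[of _ g]) auto
  qed blast
  then obtain g where "g \<in> L" "\<forall>z\<in>A. g z < f z + \<epsilon>" "\<forall>z\<in>A. f z - \<epsilon> < g z" by auto
  then have "\<forall>z\<in>A. \<bar>g z - f z\<bar> < \<epsilon>" by (simp add: abs_less_iff algebra_simps)
  with \<open>g \<in> L\<close> show ?thesis by (intro bexI[of _ g])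
qed

text \<open>
  The line through two points in the plane with distinct abscissae can be moved to one with rational
  coefficients without changing its two heights by much.
\<close>

lemma rational_affine_interpolation:
  fixes a b u v \<epsilon> :: real
  assumes "a \<noteq> b" "0 < \<epsilon>"
  shows "\<exists>p\<in>\<rat>. \<exists>q\<in>\<rat>. \<bar>p * a + q - u\<bar> < \<epsilon> \<and> \<bar>p * b + q - v\<bar> < \<epsilon>"
proof -
  define p0 where "p0 = (u - v) / (a - b)"
  define q0 where "q0 = u - p0 * a"
  have ua: "u = p0 * a + q0" by (simp add: q0_def)
  have "p0 * (a - b) = u - v" using assms(1) by (simp add: p0_def)
  then have vb: "v = p0 * b + q0" by (simp add: q0_def algebra_simps)
  define M where "M = \<bar>a\<bar> + \<bar>b\<bar> + 1"
  have M: "M > 0" "\<bar>a\<bar> \<le> M" "\<bar>b\<bar> \<le> M" unfolding M_def by auto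
  have "0 < \<epsilon> / (2 * M)" using M assms(2) by simp
  then obtain p where p: "p \<in> \<rat>" "p0 < p" "p < p0 + \<epsilon> / (2 * M)"
    using Rats_dense_in_real[of p0 "p0 + \<epsilon> / (2 * M)"] by auto
  obtain q where q: "q \<in> \<rat>" "q0 < q" "q < q0 + \<epsilon> / 2"
    using Rats_dense_in_real[of q0 "q0 + \<epsilon> / 2"] assms(2) by auto
  have bound: "\<bar>p * c + q - (p0 * c + q0)\<bar> < \<epsilon>" if "\<bar>c\<bar> \<le> M" for c
  proof -
    have "\<bar>(p - p0) * c\<bar> \<le> (p - p0) * M"
      unfolding abs_mult using p that by (intro mult_mono) auto
    also have "\<dots> \<le> \<epsilon> / (2 * M) * M"
      using p M by (intro mult_right_mono) auto
    also have "\<dots> = \<epsilon> / 2" using M by simp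
    finally have "\<bar>(p - p0) * c\<bar> \<le> \<epsilon> / 2" .
    moreover have "p * c + q - (p0 * c + q0) = (p - p0) * c + (q - q0)" by (simp add: algebra_simps)
    ultimately show ?thesis using q by linarith
  qed
  show ?thesis
    using p(1) q(1) bound[OF M(2)] bound[OF M(3)] ua vb by blast
qed

lemma countable_closure:
  assumes "countable G" "G \<subseteq> C" "countable \<O>"
    and C: "\<And>op x y. op \<in> \<O> \<Longrightarrow> x \<in> C \<Longrightarrow> y \<in> C \<Longrightarrow> op x y \<in> C"
  shows "\<exists>D. countable D \<and> G \<subseteq> D \<and> D \<subseteq> C \<and> (\<forall>op\<in>\<O>. \<forall>x\<in>D. \<forall>y\<in>D. op x y \<in> D)"
proof -
  define E where "E = rec_nat G (\<lambda>_ S. S \<union> (\<lambda>(op, x, y). op x y) ` (\<O> \<times> S \<times> S))"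
  have E0: "E 0 = G" and ES: "\<And>n. E (Suc n) = E n \<union> (\<lambda>(op, x, y). op x y) ` (\<O> \<times> E n \<times> E n)"
    by (simp_all add: E_def)
  have ES_I: "op x y \<in> E (Suc n)" if "op \<in> \<O>" "x \<in> E n" "y \<in> E n" for op x y n
    unfolding ES by (rule UnI2, rule image_eqI[where x = "(op, x, y)"]) (use that in auto)
  have "countable (E n)" for n
    by (induction n) (auto simp: E0 ES assms)
  moreover have "E n \<subseteq> C" for n
  proof (induction n)
    case (Suc n)
    have "(case z of (op, x, y) \<Rightarrow> op x y) \<in> C" if "z \<in> \<O> \<times> E n \<times> E n" for z
    proof -
      obtain op x y where "z = (op, x, y)" by (cases z)
      then show ?thesis using that Suc by (simp add: C subset_iff)
    qed
    then show ?case using Suc unfolding ES by (simp add: image_subset_iff)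
  qed (simp add: E0 assms)
  moreover have "op x y \<in> (\<Union>n. E n)" if "op \<in> \<O>" and xy: "x \<in> (\<Union>n. E n)" "y \<in> (\<Union>n. E n)" for op x y
  proof -
    have mono: "E m \<subseteq> E n" if "m \<le> n" for m n
      using lift_Suc_mono_le[of E, OF _ that] ES by auto
    obtain i j where "x \<in> E i" "y \<in> E j" using xy by (elim UN_E) (rule that)
    then have "x \<in> E (max i j)" "y \<in> E (max i j)"
      using subsetD[OF mono[of i "max i j"]] subsetD[OF mono[of j "max i j"]] by simp_all
    then have "op x y \<in> E (Suc (max i j))" by (rule ES_I[OF \<open>op \<in> \<O>\<close>])
    then show ?thesis by (rule UN_I[OF UNIV_I])
  qed
  moreover have "G \<subseteq> (\<Union>n. E n)" using E0 by (metis UNIV_I UN_upper)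
  ultimately show ?thesis
    by (intro exI[of _ "\<Union>n. E n"] conjI ballI countable_UN UN_least) simp_all
qed

section \<open>A dense set closed under gluing\<close>

definition glue :: "'a topology \<Rightarrow> ('a \<Rightarrow> real) \<Rightarrow> ('a \<Rightarrow> real) \<Rightarrow> ('a \<Rightarrow> real) \<Rightarrow> 'a \<Rightarrow> real" where
  "glue X \<psi> h g = restrict (\<lambda>x. (1 - \<psi> x) * g x + \<psi> x * h x) (topspace X)"

lemma glue_in_cont_funs:
  assumes "\<psi> \<in> cont_funs X" "h \<in> cont_funs X" "g \<in> cont_funs X"
  shows "glue X \<psi> h g \<in> cont_funs X"
  unfolding glue_def using assms[THEN cont_funs_continuous]
  by (intro restrict_in_cont_funs continuous_intros) auto

text \<open>
  The equations are imposed one at a time. Gluing keeps the approximation on \<open>A\<close> with the same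
  \<open>\<epsilon>\<close>, since a convex combination of two numbers within \<open>\<epsilon>\<close> of \<open>f x\<close> is again within \<open>\<epsilon>\<close> of it.
\<close>

lemma hit_values_by_gluing:
  assumes haus: "Hausdorff_space X"
    and D: "D \<subseteq> cont_funs X" "\<And>\<psi> h g. \<psi> \<in> \<Psi> \<Longrightarrow> h \<in> H \<Longrightarrow> g \<in> D \<Longrightarrow> glue X \<psi> h g \<in> D"
    and bump: "bump_family X \<Psi>" and level: "level_family X H" "countable H"
    and f: "f \<in> cont_funs X" and A: "A \<subseteq> topspace X" and \<epsilon>: "0 < \<epsilon>"
    and approx: "\<exists>g\<in>D. \<forall>x\<in>A. \<bar>g x - f x\<bar> < \<epsilon>"
    and S: "finite S" "S \<subseteq> topspace X" and U: "\<And>s. s \<in> topspace X \<Longrightarrow> openin X (U s) \<and> s \<in> U s"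
  shows "\<exists>g\<in>D. (\<forall>x\<in>A. \<bar>g x - f x\<bar> < \<epsilon>) \<and> (\<forall>s\<in>S. \<exists>y\<in>U s. g y = f s)"
  using S
proof (induction rule: finite_induct)
  case empty
  then show ?case using approx by auto
next
  case (insert s S)
  then obtain g where g: "g \<in> D" "\<forall>x\<in>A. \<bar>g x - f x\<bar> < \<epsilon>" "\<forall>s\<in>S. \<exists>y\<in>U s. g y = f s" by auto
  then obtain w where w: "\<And>t. t \<in> S \<Longrightarrow> w t \<in> U t \<and> g (w t) = f t" by metis
  have s: "s \<in> topspace X" using insert.prems by blast
  \<comment> \<open>The new bump lives in \<open>W\<close>: near \<open>s\<close>, where \<open>f\<close> is almost \<open>f s\<close>, and away from the points \<open>w t\<close>
      where the earlier equations hold.\<close>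
  define W0 where "W0 = {x \<in> U s. f x \<in> ball (f s) (\<epsilon> / 2)}"
  define W where "W = W0 - w ` S"
  have W0: "openin X W0" "s \<in> W0"
    unfolding W0_def
    using openin_continuous_map_preimage_gen[OF cont_funs_continuous[OF f], of "U s" "ball (f s) (\<epsilon> / 2)"]
      U[OF s] \<epsilon> by auto
  have "w ` S \<subseteq> topspace X"
    using w U insert.prems openin_subset by blast
  then have "closedin X (w ` S)"
    using haus \<open>finite S\<close> closedin_Hausdorff_finite by blast
  then have "openin X W" unfolding W_def using W0 by blast
  moreover have "W \<noteq> {}"
  proof
    assume "W = {}"
    then have "countable W0"
      unfolding W_def using \<open>finite S\<close> by (meson Diff_eq_empty_iff countable_finite countable_subset finite_imageI)
    then show False using level_family_imp_uncountable_open[OF level(2,1) W0(1)] W0(2) by blast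
  qed
  ultimately have "\<exists>\<psi>\<in>\<Psi>. \<exists>Q. openin X Q \<and> Q \<noteq> {} \<and> Q \<subseteq> W \<and>
      (\<forall>x\<in>Q. \<psi> x = 1) \<and> (\<forall>x\<in>topspace X - W. \<psi> x = 0)"
    using bump unfolding bump_family_def by simp
  then obtain \<psi> Q where \<psi>: "\<psi> \<in> \<Psi>" "openin X Q" "Q \<noteq> {}" "Q \<subseteq> W" "\<forall>x\<in>Q. \<psi> x = 1"
      "\<forall>x\<in>topspace X - W. \<psi> x = 0"
    by (elim bexE exE conjE) (rule that)
  have \<psi>01: "\<forall>x\<in>topspace X. 0 \<le> \<psi> x \<and> \<psi> x \<le> 1"
    using bump \<psi>(1) unfolding bump_family_def by simp
  have "\<exists>h\<in>H. (\<forall>x\<in>topspace X. \<bar>h x - f s\<bar> < \<epsilon> / 2) \<and> (\<exists>y\<in>Q. h y = f s)"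
    using level(1) \<psi>(2,3) half_gt_zero[OF \<epsilon>] unfolding level_family_def by blast
  then obtain h y where h: "h \<in> H" "\<forall>x\<in>topspace X. \<bar>h x - f s\<bar> < \<epsilon> / 2" and y: "y \<in> Q" "h y = f s"
    by (elim bexE conjE) (rule that)
  define k where "k = glue X \<psi> h g"
  have "k \<in> D" unfolding k_def using D(2) \<psi>(1) h(1) g(1) by blast
  moreover have "\<bar>k x - f x\<bar> < \<epsilon>" if "x \<in> A" for x
  proof (cases "x \<in> W")
    case False
    then show ?thesis using \<psi>(6) A g(2) that by (auto simp: k_def glue_def)
  next
    case True
    have xt: "x \<in> topspace X" using that A by blast
    have "\<bar>f s - f x\<bar> < \<epsilon> / 2" using True by (auto simp: W_def W0_def dist_real_def)
    moreover have "\<bar>h x - f s\<bar> < \<epsilon> / 2" using h(2) xt by blast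
    ultimately have "\<bar>h x - f x\<bar> < \<epsilon>" by linarith
    then have "h x - f x \<in> ball 0 \<epsilon>" by (simp add: dist_real_def)
    moreover have "g x - f x \<in> ball 0 \<epsilon>" using g(2) that by (simp add: dist_real_def abs_minus_commute)
    ultimately have "(1 - \<psi> x) *\<^sub>R (g x - f x) + \<psi> x *\<^sub>R (h x - f x) \<in> ball 0 \<epsilon>"
      using \<psi>01 xt by (intro convexD[OF convex_ball]) auto
    moreover have "k x - f x = (1 - \<psi> x) *\<^sub>R (g x - f x) + \<psi> x *\<^sub>R (h x - f x)"
      using xt by (simp add: k_def glue_def algebra_simps)
    ultimately show ?thesis by (simp add: dist_real_def)
  qed
  moreover have "\<exists>z\<in>U t. k z = f t" if "t \<in> insert s S" for t
  proof (cases "t \<in> S")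
    case True
    have "w t \<in> topspace X - W" using True \<open>w ` S \<subseteq> topspace X\<close> by (auto simp: W_def)
    then have "k (w t) = g (w t)" using \<psi>(6) by (simp add: k_def glue_def)
    then show ?thesis using w[OF True] by auto
  next
    case False
    then have "t = s" using that by blast
    have "y \<in> U s" using y \<psi>(4) by (auto simp: W_def W0_def)
    moreover have "y \<in> topspace X" using y \<psi>(2) openin_subset by blast
    then have "k y = f s" using y \<psi>(5) by (simp add: k_def glue_def)
    ultimately show ?thesis using \<open>t = s\<close> by blast
  qed
  ultimately show ?case by (intro bexI[of _ k]) auto
qed

lemma C_kh_separable:
  assumes tych: "tychonoff_space X" and P: "countable \<P>" "pi_base X \<P>"
    and "R_separable X" "submetrizable_space X"
  shows "separable_space (C_kh X)"
proof -
  obtain F where F: "countable F" "F \<subseteq> cont_funs X" "separates_points X F"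
    using countable_separating_family[OF assms(5) separable_if_countable_pi_base[OF P]] by blast
  obtain \<Psi> where \<Psi>: "countable \<Psi>" "bump_family X \<Psi>"
    using countable_bump_family P tych unfolding tychonoff_space_def by blast
  obtain H where H: "countable H" "level_family X H"
    using countable_level_family assms(4) by blast
  have \<Psi>c: "\<Psi> \<subseteq> cont_funs X" and Hc: "H \<subseteq> cont_funs X"
    using \<Psi> H by (auto simp: bump_family_def level_family_def)
  \<comment> \<open>The function \<open>0\<close> is added so that rational constants are present even if \<open>F\<close> is empty.\<close>
  define aff where "aff = (\<lambda>(p :: real, q, \<phi>). restrict (\<lambda>x. p * \<phi> x + q) (topspace X))"
  define G where "G = aff ` (\<rat> \<times> \<rat> \<times> insert (\<lambda>_. 0) F)"
  have "countable G" unfolding G_def using F(1) countable_rat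
    by (intro countable_image countable_SIGMA) auto
  have "G \<subseteq> cont_funs X"
    unfolding G_def aff_def using F(2) cont_funs_continuous
    by (auto intro!: restrict_in_cont_funs continuous_map_add continuous_map_real_mult)
  define mx where "mx = (\<lambda>g h :: 'a \<Rightarrow> real. restrict (\<lambda>x. max (g x) (h x)) (topspace X))"
  define mn where "mn = (\<lambda>g h :: 'a \<Rightarrow> real. restrict (\<lambda>x. min (g x) (h x)) (topspace X))"
  \<comment> \<open>Gluing enters as a binary operation that is constant in its second argument.\<close>
  define \<O> where "\<O> = {mx, mn} \<union> (\<lambda>(\<psi>, h) g _. glue X \<psi> h g) ` (\<Psi> \<times> H)"
  have "countable \<O>" unfolding \<O>_def using \<Psi>(1) H(1) by auto
  have ops: "op g h \<in> cont_funs X" if "op \<in> \<O>" "g \<in> cont_funs X" "h \<in> cont_funs X" for op g h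
  proof -
    from \<open>op \<in> \<O>\<close> consider "op = mx" | "op = mn"
      | \<psi> h where "\<psi> \<in> \<Psi>" "h \<in> H" "op = (\<lambda>g _. glue X \<psi> h g)"
      unfolding \<O>_def by auto
    then show ?thesis
    proof cases
      case 3
      then show ?thesis using \<Psi>c Hc that(2) by (simp add: glue_in_cont_funs subset_iff)
    qed (use that(2,3)[THEN cont_funs_continuous] in
      \<open>auto simp: mx_def mn_def intro!: restrict_in_cont_funs continuous_map_real_max continuous_map_real_min\<close>)
  qed
  have "\<exists>D. countable D \<and> G \<subseteq> D \<and> D \<subseteq> cont_funs X \<and> (\<forall>op\<in>\<O>. \<forall>g\<in>D. \<forall>h\<in>D. op g h \<in> D)"
    by (rule countable_closure[OF \<open>countable G\<close> \<open>G \<subseteq> cont_funs X\<close> \<open>countable \<O>\<close>]) (rule ops)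
  then obtain D where D: "countable D" "G \<subseteq> D" "D \<subseteq> cont_funs X"
      and cl: "\<forall>op\<in>\<O>. \<forall>g\<in>D. \<forall>h\<in>D. op g h \<in> D"
    by (elim exE conjE) (rule that)
  have cl_mx: "mx g h \<in> D" and cl_mn: "mn g h \<in> D" if "g \<in> D" "h \<in> D" for g h
    using cl that by (auto simp: \<O>_def)
  have cl_glue: "glue X \<psi> h g \<in> D" if "\<psi> \<in> \<Psi>" "h \<in> H" "g \<in> D" for \<psi> h g
  proof -
    have "(\<lambda>g _. glue X \<psi> h g) \<in> \<O>" unfolding \<O>_def using that by force
    with cl have "\<forall>g\<in>D. \<forall>k\<in>D. glue X \<psi> h g \<in> D" by (rule bspec)
    then show ?thesis using that(3) by blast
  qed
  have affD: "restrict (\<lambda>x. p * \<phi> x + q) (topspace X) \<in> D" if "p \<in> \<rat>" "q \<in> \<rat>" "\<phi> \<in> insert (\<lambda>_. 0) F" for p q \<phi>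
  proof -
    have "aff (p, q, \<phi>) \<in> D" using D(2) that unfolding G_def by blast
    then show ?thesis by (simp add: aff_def)
  qed
  have two: "\<exists>g\<in>D. \<bar>g x - f x\<bar> < \<epsilon> \<and> \<bar>g y - f y\<bar> < \<epsilon>"
    if xy: "x \<in> topspace X" "y \<in> topspace X" and \<epsilon>: "0 < \<epsilon>" for x y f and \<epsilon> :: real
  proof (cases "x = y")
    case True
    obtain q where "q \<in> \<rat>" "f x < q" "q < f x + \<epsilon>"
      using Rats_dense_in_real[of "f x" "f x + \<epsilon>"] \<epsilon> by auto
    then show ?thesis
      using affD[of 0 q "\<lambda>_. 0"] xy True by (intro bexI[of _ "restrict (\<lambda>x. 0 * 0 + q) (topspace X)"]) auto
  next
    case False
    then obtain \<phi> where \<phi>: "\<phi> \<in> F" "\<phi> x \<noteq> \<phi> y"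
      using F(3) xy unfolding separates_points_def by blast
    obtain p q where "p \<in> \<rat>" "q \<in> \<rat>" "\<bar>p * \<phi> x + q - f x\<bar> < \<epsilon>" "\<bar>p * \<phi> y + q - f y\<bar> < \<epsilon>"
      using rational_affine_interpolation[OF \<phi>(2) \<epsilon>, of "f x" "f y"]
      by (elim bexE conjE) (rule that)
    then show ?thesis
      using affD[of p q \<phi>] \<phi>(1) xy
      by (intro bexI[of _ "restrict (\<lambda>x. p * \<phi> x + q) (topspace X)"]) auto
  qed
  have approx: "\<exists>g\<in>D. \<forall>x\<in>A. \<bar>g x - f x\<bar> < \<epsilon>"
    if f: "f \<in> cont_funs X" and A: "compactin X A" and \<epsilon>: "0 < \<epsilon>" for f A \<epsilon>
  proof (rule lattice_approximation[OF A])
    show "D \<noteq> {}" using affD[of 0 0 "\<lambda>_. 0"] by auto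
    show "continuous_map X euclideanreal g" if "g \<in> D" for g
      using that D(3) cont_funs_continuous by blast
    have At: "A \<subseteq> topspace X" using A by (rule compactin_subset_topspace)
    show "\<exists>k\<in>D. \<forall>x\<in>A. k x = max (g x) (h x)" if "g \<in> D" "h \<in> D" for g h
      using cl_mx[OF that] At by (intro bexI[of _ "mx g h"]) (auto simp: mx_def)
    show "\<exists>k\<in>D. \<forall>x\<in>A. k x = min (g x) (h x)" if "g \<in> D" "h \<in> D" for g h
      using cl_mn[OF that] At by (intro bexI[of _ "mn g h"]) (auto simp: mn_def)
    show "continuous_map X euclideanreal f" using f by (rule cont_funs_continuous)
    show "\<exists>g\<in>D. \<bar>g x - f x\<bar> < \<epsilon> \<and> \<bar>g y - f y\<bar> < \<epsilon>" if "x \<in> A" "y \<in> A" for x y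
      by (rule two) (use that At \<epsilon> in auto)
  qed
  have "C_kh X closure_of D = topspace (C_kh X)"
    unfolding dense_intersects_open
  proof (intro allI impI)
    fix O' assume O': "openin (C_kh X) O' \<and> O' \<noteq> {}"
    then obtain f where f: "f \<in> O'" by blast
    then have fc: "f \<in> cont_funs X" using O' openin_subset topspace_C_kh by blast
    obtain A \<epsilon> S U where N: "compactin X A" "0 < \<epsilon>" "finite S" "S \<subseteq> topspace X"
        "\<forall>s\<in>topspace X. openin X (U s) \<and> s \<in> U s"
        "\<forall>g\<in>cont_funs X. (\<forall>x\<in>A. \<bar>g x - f x\<bar> < \<epsilon>) \<and> (\<forall>s\<in>S. \<exists>y\<in>U s. g y = f s) \<longrightarrow> g \<in> O'"
      using C_kh_neighbourhood[of X O' f] O' f by (elim conjE) blast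
    have haus: "Hausdorff_space X" using tych by (simp add: tychonoff_space_def)
    have "\<exists>g\<in>D. (\<forall>x\<in>A. \<bar>g x - f x\<bar> < \<epsilon>) \<and> (\<forall>s\<in>S. \<exists>y\<in>U s. g y = f s)"
      by (rule hit_values_by_gluing[OF haus D(3) cl_glue \<Psi>(2) H(2,1) fc
          compactin_subset_topspace[OF N(1)] N(2) approx[OF fc N(1,2)] N(3,4)])
        (use N(5) in auto)
    then obtain g where "g \<in> D" "(\<forall>x\<in>A. \<bar>g x - f x\<bar> < \<epsilon>) \<and> (\<forall>s\<in>S. \<exists>y\<in>U s. g y = f s)"
      by (rule bexE)
    moreover from this have "g \<in> O'" using N(6) D(3) by auto
    ultimately show "D \<inter> O' \<noteq> {}" by blast
  qed
  moreover have "D \<subseteq> topspace (C_kh X)" unfolding topspace_C_kh by (rule D(3))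
  ultimately show ?thesis
    unfolding separable_space_def using D(1) by (intro exI[of _ D] conjI)
qed

section \<open>Consequences of separability\<close>

lemma C_kh_separable_imp_C_ph:
  assumes "separable_space (C_kh X)"
  shows "separable_space (C_ph X)"
proof -
  obtain D where D: "countable D" "D \<subseteq> cont_funs X" "C_kh X closure_of D = topspace (C_kh X)"
    using assms unfolding separable_space_def topspace_C_kh by blast
  have "C_ph X closure_of D = topspace (C_ph X)"
    using D(3) openin_C_ph_imp_C_kh unfolding dense_intersects_open by blast
  with D(1,2) show ?thesis
    unfolding separable_space_def by (intro exI[of _ D]) (simp add: topspace_C_ph)
qed

text \<open>
  The constant function \<open>r\<close> lies in the open set \<open>minus_set X U r\<close>, so a dense set has a member that
  takes the value \<open>r\<close> on \<open>U\<close>; the enumeration of \<open>D\<close> thus serves all \<open>r\<close> at once.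
\<close>

lemma C_ph_dense_imp_R_set:
  assumes D: "countable D" "D \<subseteq> cont_funs X" "C_ph X closure_of D = topspace (C_ph X)"
    and U: "openin X U" "U \<noteq> {}"
  shows "R_set X U"
proof -
  have hit: "\<exists>f\<in>D. r \<in> f ` U" for r
  proof -
    have "restrict (\<lambda>_. r) (topspace X) \<in> minus_set X U r"
      unfolding minus_set_def using U openin_subset restrict_in_cont_funs[of X "\<lambda>_. r"] by fastforce
    then have "D \<inter> minus_set X U r \<noteq> {}"
      using D(3) openin_C_ph_minus_set[OF U(1)] unfolding dense_intersects_open by blast
    then show ?thesis unfolding minus_set_def by blast
  qed
  then have "D \<noteq> {}" by blast
  then have rng: "range (from_nat_into D) = D" using D(1) by (rule range_from_nat_into)
  have "(\<forall>n. from_nat_into D n \<in> cont_funs X) \<and> (\<Union>n. from_nat_into D n ` U) = UNIV"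
  proof
    show "\<forall>n. from_nat_into D n \<in> cont_funs X" using rng D(2) by blast
    have "(\<Union>n. from_nat_into D n ` U) = (\<Union>f\<in>range (from_nat_into D). f ` U)" by simp
    also have "\<dots> = (\<Union>f\<in>D. f ` U)" unfolding rng ..
    also have "\<dots> = UNIV" using hit by blast
    finally show "(\<Union>n. from_nat_into D n ` U) = UNIV" .
  qed
  then have "\<exists>f. (\<forall>n :: nat. f n \<in> cont_funs X) \<and> (\<Union>n. f n ` U) = UNIV"
    by (rule exI[of _ "from_nat_into D"])
  moreover have "U \<subseteq> topspace X" using U(1) by (rule openin_subset)
  ultimately show ?thesis unfolding R_set_def using U(2) by simp
qed

lemma C_ph_dense_imp_separates_points:
  assumes tych: "tychonoff_space X"
    and D: "C_ph X closure_of D = topspace (C_ph X)"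
  shows "separates_points X D"
  unfolding separates_points_def
proof (intro ballI impI)
  fix x y assume xy: "x \<in> topspace X" "y \<in> topspace X" "x \<noteq> y"
  have "closedin X {y}"
    using tych xy by (simp add: tychonoff_space_def closedin_Hausdorff_singleton)
  then obtain f :: "'a \<Rightarrow> real" where f: "continuous_map X (top_of_set {0..1}) f" "f x = 0" "f ` {y} \<subseteq> {1}"
    using tych xy unfolding tychonoff_space_def completely_regular_space_def by blast
  then have fc: "restrict f (topspace X) \<in> cont_funs X"
    by (auto simp: continuous_map_in_subtopology intro: restrict_in_cont_funs)
  let ?O = "plus_set X {x} {..<1/2} \<inter> plus_set X {y} {1/2<..}"
  have "openin (C_ph X) ?O"
    using xy by (intro openin_Int openin_C_ph_plus_set) auto
  moreover have "restrict f (topspace X) \<in> ?O"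
    using fc f xy by (auto simp: plus_set_def)
  ultimately have "D \<inter> ?O \<noteq> {}" using D unfolding dense_intersects_open by blast
  then obtain g where "g \<in> D" "g x < 1/2" "1/2 < g y" by (auto simp: plus_set_def)
  then show "\<exists>f\<in>D. f x \<noteq> f y" by (intro bexI[of _ g]) auto
qed

theorem theorem4p3:
  fixes X :: "'a topology"
  assumes "tychonoff_space X"
    and "\<exists>\<P>. countable \<P> \<and> pi_base X \<P>"
  shows "(separable_space (C_kh X) \<longleftrightarrow> separable_space (C_ph X)) \<and>
         (separable_space (C_ph X) \<longleftrightarrow> R_separable X \<and> submetrizable_space X)"
proof -
  obtain \<P> where P: "countable \<P>" "pi_base X \<P>" using assms(2) by blast
  have "R_separable X \<and> submetrizable_space X" if sep: "separable_space (C_ph X)"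
  proof -
    obtain D where D: "countable D" "D \<subseteq> cont_funs X" "C_ph X closure_of D = topspace (C_ph X)"
      using sep unfolding separable_space_def topspace_C_ph by blast
    have "\<forall>B\<in>\<P>. R_set X B"
      using C_ph_dense_imp_R_set[OF D] P(2) unfolding pi_base_def by blast
    then have "R_separable X"
      unfolding R_separable_def using P unfolding pi_base_def by blast
    moreover have "submetrizable_space X"
      using submetrizable_if_separates_points C_ph_dense_imp_separates_points assms(1) D by blast
    ultimately show ?thesis by blast
  qed
  then show ?thesis
    using C_kh_separable[OF assms(1) P] C_kh_separable_imp_C_ph by blast
qed

end
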